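(* Let $C\subseteq\mathbb{R}^n$ be a non-empty convex set, let $V:\mathbb{R}^m\to\overline{\mathbb{R}}$ be proper, convex and lower semicontinuous, let $\Phi:\mathbb{R}^n\to\mathbb{R}^m$ be a nonlinear, locally Lipschitz continuous mapping, and let $f(x)=V(\Phi(x))$ for $x\in C$, $f(x)=+\infty$ otherwise. Consider the primal problem $\min_{x\in\mathbb{R}^n}f(x)$, the associated Lagrangian $L$ given by $L(x,\sigma)=\langle\Phi(x),\sigma\rangle-V^*(\sigma)$ for $(x,\sigma)\in C\times D$, and the set $D^+=\{\sigma\in D: L(\cdot,\sigma)\text{ is convex in }x\}$. Assume that $(\bar x,\bar\sigma)$ is a stationary point of $L$ (i.e. $0\in\partial_xL(\bar x,\bar\sigma)$ and $0\in\partial_\sigma L(\bar x,\bar\sigma)$) with $(\bar x,\bar\sigma)\in C\times D^+$. Then $$L(\bar x,\sigma)\le L(\bar x,\bar\sigma)\le L(x,\bar\sigma)\qquad\forall\,x\in C,\ \forall\,\sigma\in D^+,$$ that is, $(\bar x,\bar\sigma)$ is a min-max saddle point of $L$. Furthermore, $\bar x$ is a global solution of the primal problem $\min_{x\in\mathbb{R}^n} f(x)$.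
   Context: $\overline{\mathbb{R}}=[-\infty,\infty]$. A function is proper if it never takes the value $-\infty$ and is not identically $+\infty$. $V^*(\sigma)=\sup_{y\in\mathbb{R}^m}\{\langle y,\sigma\rangle-V(y)\}$ is the convex conjugate of $V$ and $D=\{\sigma\in\mathbb{R}^m: V^*(\sigma)<\infty\}$. The Lagrangian is extended by $L(x,\sigma)=-\infty$ if $x\in C,\sigma\notin D$, and $L(x,\sigma)=+\infty$ if $x\notin C,\sigma\in D$. $\partial_xL(\bar x,\bar\sigma)$ is the subdifferential at $\bar x$ of $x\mapsto L(x,\bar\sigma)$ (the convex subdifferential, since this function is convex for $\bar\sigma\in D^+$); for the concave function $\sigma\mapsto L(\bar x,\sigma)$ the convention is $\partial_\sigma L(\bar x,\bar\sigma)=\Phi(\bar x)-\partial V^*(\bar\sigma)=\{\Phi(\bar x)-v: v\in\partial V^*(\bar\sigma)\}$, with $\partial V^*$ the convex subdifferential. *)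

theory Defs
  imports "HOL-Analysis.Analysis"
begin

definition proper_fun :: "('a \<Rightarrow> ereal) \<Rightarrow> bool"
  where "proper_fun g \<longleftrightarrow> (\<forall>x. g x \<noteq> -\<infinity>) \<and> (\<exists>x. g x \<noteq> \<infinity>)"

(* Convexity is stated through the epigraph because an inequality between convex combinations
   would depend on the ereal convention for sums of opposite infinities. *)
definition convex_fun :: "('a::real_vector \<Rightarrow> ereal) \<Rightarrow> bool"
  where "convex_fun g \<longleftrightarrow> convex {(x, r::real). g x \<le> ereal r}"

definition lsc_fun :: "('a::topological_space \<Rightarrow> ereal) \<Rightarrow> bool"
  where "lsc_fun g \<longleftrightarrow> (\<forall>x. g x \<le> Liminf (at x) g)"

definition locally_lipschitz :: "('a::metric_space \<Rightarrow> 'b::metric_space) \<Rightarrow> bool"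
  where "locally_lipschitz F \<longleftrightarrow> (\<forall>x. \<exists>e>0. \<exists>K. K-lipschitz_on (cball x e) F)"

definition conjugate :: "('a::real_inner \<Rightarrow> ereal) \<Rightarrow> 'a \<Rightarrow> ereal"
  where "conjugate V \<sigma> = (SUP y. ereal (y \<bullet> \<sigma>) - V y)"

definition conj_dom :: "('a::real_inner \<Rightarrow> ereal) \<Rightarrow> 'a set"
  where "conj_dom V = {\<sigma>. conjugate V \<sigma> < \<infinity>}"

(* As usual, the subdifferential is empty at points where the function is not finite. *)
definition subdifferential :: "('a::real_inner \<Rightarrow> ereal) \<Rightarrow> 'a \<Rightarrow> 'a set"
  where "subdifferential g x =
    {s. \<bar>g x\<bar> \<noteq> \<infinity> \<and> (\<forall>y. g x + ereal (s \<bullet> (y - x)) \<le> g y)}"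

definition primal ::
  "'a set \<Rightarrow> ('b \<Rightarrow> ereal) \<Rightarrow> ('a \<Rightarrow> 'b) \<Rightarrow> 'a \<Rightarrow> ereal"
  where "primal C V \<Phi> x = (if x \<in> C then V (\<Phi> x) else \<infinity>)"

(* No value is prescribed when x is outside C and \<sigma> is outside the domain of the conjugate;
   hence the last branch is left unspecified. *)
definition lagrangian ::
  "'a set \<Rightarrow> ('b::real_inner \<Rightarrow> ereal) \<Rightarrow> ('a \<Rightarrow> 'b) \<Rightarrow> 'a \<Rightarrow> 'b \<Rightarrow> ereal"
  where "lagrangian C V \<Phi> x \<sigma> =
    (if x \<in> C \<and> \<sigma> \<in> conj_dom V then ereal (\<Phi> x \<bullet> \<sigma>) - conjugate V \<sigma>
     else if x \<in> C then -\<infinity>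
     else if \<sigma> \<in> conj_dom V then \<infinity>
     else undefined)"

definition conj_dom_plus ::
  "'a::real_vector set \<Rightarrow> ('b::real_inner \<Rightarrow> ereal) \<Rightarrow> ('a \<Rightarrow> 'b) \<Rightarrow> 'b set"
  where "conj_dom_plus C V \<Phi> =
    {\<sigma> \<in> conj_dom V. convex_fun (\<lambda>x. lagrangian C V \<Phi> x \<sigma>)}"

definition partial_x ::
  "'a::real_inner set \<Rightarrow> ('b::real_inner \<Rightarrow> ereal) \<Rightarrow> ('a \<Rightarrow> 'b) \<Rightarrow> 'a \<Rightarrow> 'b \<Rightarrow> 'a set"
  where "partial_x C V \<Phi> x \<sigma> = subdifferential (\<lambda>z. lagrangian C V \<Phi> z \<sigma>) x"

(* By convention, the partial subdifferential in the concave variable is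
   expressed through the subdifferential of the conjugate. *)
definition partial_sigma ::
  "('b::real_inner \<Rightarrow> ereal) \<Rightarrow> ('a \<Rightarrow> 'b) \<Rightarrow> 'a \<Rightarrow> 'b \<Rightarrow> 'b set"
  where "partial_sigma V \<Phi> x \<sigma> = {\<Phi> x - v | v. v \<in> subdifferential (conjugate V) \<sigma>}"

definition stationary_point ::
  "'a::real_inner set \<Rightarrow> ('b::real_inner \<Rightarrow> ereal) \<Rightarrow> ('a \<Rightarrow> 'b) \<Rightarrow> 'a \<Rightarrow> 'b \<Rightarrow> bool"
  where "stationary_point C V \<Phi> x \<sigma> \<longleftrightarrow>
    0 \<in> partial_x C V \<Phi> x \<sigma> \<and> 0 \<in> partial_sigma V \<Phi> x \<sigma>"

end

(*
  Stationarity in \<sigma> says \<Phi> xbar \<in> \<partial>V*(\<sigma>bar), which is the left inequality; stationarity in x is the right one.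
  By a form of Fenchel-Moreau duality the subgradient condition also gives V(\<Phi> xbar) = L(xbar, \<sigma>bar),
  whereas V(\<Phi> x) \<ge> L(x, \<sigma>bar) for every x \<in> C by the Fenchel-Young inequality.
*)
theory Submission
  imports Defs
begin

text \<open>If a limit \<open>(x, r)\<close> of epigraph points had \<open>r\<close> below
  \<open>g x\<close>, some real \<open>s\<close> would lie strictly between. Lower semicontinuity
  keeps \<open>g\<close> above \<open>s\<close> near \<open>x\<close>, while the second coordinates
  eventually drop below \<open>s\<close>.\<close>

lemma closed_epigraph:
  fixes g :: "'a::metric_space \<Rightarrow> ereal"
  assumes "lsc_fun g"
  shows "closed {(x, r::real). g x \<le> ereal r}"
  unfolding closed_sequential_limits
proof (intro allI impI, elim conjE)
  fix u l
  assume u: "\<forall>n. u n \<in> {(x, r::real). g x \<le> ereal r}" and lim: "u \<longlonglongrightarrow> l"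
  obtain x r where l: "l = (x, r)" by (cases l)
  have x: "(\<lambda>n. fst (u n)) \<longlonglongrightarrow> x" and r: "(\<lambda>n. snd (u n)) \<longlonglongrightarrow> r"
    using tendsto_fst[OF lim] tendsto_snd[OF lim] by (simp_all add: l)
  have "g x \<le> ereal r"
  proof (rule ccontr)
    assume "\<not> g x \<le> ereal r"
    then obtain s where s: "ereal r < ereal s" "ereal s < g x"
      by (meson ereal_dense2 not_le)
    then have "ereal s < Liminf (at x) g"
      using assms unfolding lsc_fun_def by (meson less_le_trans)
    then have "eventually (\<lambda>z. ereal s < g z) (at x)"
      by (rule less_LiminfD)
    \<comment> \<open>The sequence may hit \<open>x\<close> itself, so the punctured neighbourhood
      is filled in using \<open>s < g x\<close>.\<close>
    then have "eventually (\<lambda>z. ereal s < g z) (nhds x)"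
      using s(2) unfolding eventually_at_filter
      by (auto elim!: eventually_mono)
    then have 1: "eventually (\<lambda>n. ereal s < g (fst (u n))) sequentially"
      using x by (rule eventually_compose_filterlim)
    have 2: "eventually (\<lambda>n. snd (u n) < s) sequentially"
      using order_tendstoD(2)[OF r, of s] s(1) by simp
    from eventually_happens[OF eventually_conj[OF 1 2]] obtain n
      where n: "ereal s < g (fst (u n))" "snd (u n) < s" by auto
    moreover have "g (fst (u n)) \<le> ereal (snd (u n))"
      using u by (auto simp: case_prod_beta)
    ultimately have "ereal s < ereal (snd (u n))" by (meson less_le_trans)
    with n(2) show False by simp
  qed
  then show "l \<in> {(x, r::real). g x \<le> ereal r}" by (simp add: l)
qed

lemma fenchel_young:
  assumes "\<bar>conjugate V \<sigma>\<bar> \<noteq> \<infinity>"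
  shows "ereal (y \<bullet> \<sigma>) - conjugate V \<sigma> \<le> V y"
proof -
  have "ereal (y \<bullet> \<sigma>) - V y \<le> conjugate V \<sigma>"
    unfolding conjugate_def by (rule SUP_upper) simp
  then show ?thesis
    using assms by (cases "V y"; cases "conjugate V \<sigma>") auto
qed

text \<open>Only finite values of \<open>V\<close> have to be checked: properness excludes
  \<open>-\<infinity>\<close>, and points with \<open>V y = \<infinity>\<close> contribute
  \<open>-\<infinity>\<close> to the supremum.\<close>

lemma conjugate_le:
  assumes "proper_fun V" and "\<And>y r. V y = ereal r \<Longrightarrow> y \<bullet> \<sigma> - r \<le> k"
  shows "conjugate V \<sigma> \<le> ereal k"
  unfolding conjugate_def
proof (rule SUP_least)
  fix y
  show "ereal (y \<bullet> \<sigma>) - V y \<le> ereal k"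
    using assms unfolding proper_fun_def by (cases "V y") auto
qed

text \<open>Rearranged subgradient inequality: \<open>\<sigma>\<close> maximises the function of
  \<open>\<tau>\<close> whose supremum is the biconjugate of \<open>V\<close> at
  \<open>y\<close>.\<close>

lemma subdifferential_conjugate_D:
  assumes "y \<in> subdifferential (conjugate V) \<sigma>"
  shows "ereal (y \<bullet> \<tau>) - conjugate V \<tau> \<le> ereal (y \<bullet> \<sigma>) - conjugate V \<sigma>"
proof -
  have "\<bar>conjugate V \<sigma>\<bar> \<noteq> \<infinity>"
    and "conjugate V \<sigma> + ereal (y \<bullet> (\<tau> - \<sigma>)) \<le> conjugate V \<tau>"
    using assms by (auto simp: subdifferential_def)
  then show ?thesis
    by (cases "conjugate V \<sigma>"; cases "conjugate V \<tau>") (auto simp: inner_diff_right)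
qed

text \<open>Otherwise \<open>(y, y \<bullet> \<sigma> - q)\<close>, with \<open>q\<close> the value
  of the conjugate at \<open>\<sigma>\<close>, lies strictly below the closed convex epigraph of
  \<open>V\<close>. A separating hyperplane then yields an affine minorant of \<open>V\<close> that
  is too large at \<open>y\<close>, against the maximality of \<open>\<sigma>\<close>.\<close>

lemma subdifferential_conjugate_le:
  fixes V :: "'a::euclidean_space \<Rightarrow> ereal"
  assumes V: "proper_fun V" "convex_fun V" "lsc_fun V"
    and y: "y \<in> subdifferential (conjugate V) \<sigma>"
  shows "V y \<le> ereal (y \<bullet> \<sigma>) - conjugate V \<sigma>"
proof (rule ccontr)
  assume neg: "\<not> ?thesis"
  obtain q where q: "conjugate V \<sigma> = ereal q"
    using y by (auto simp: subdifferential_def)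
  define E where "E = {(x, r::real). V x \<le> ereal r}"
  have "closed E" "convex E"
    using closed_epigraph V unfolding E_def convex_fun_def by auto
  moreover have "(y, y \<bullet> \<sigma> - q) \<notin> E"
    using neg q by (simp add: E_def)
  ultimately obtain n c where n: "n \<bullet> (y, y \<bullet> \<sigma> - q) < c" "\<forall>p\<in>E. c < n \<bullet> p"
    using separating_hyperplane_closed_point by metis
  obtain a b where [simp]: "n = (a, b)" by (cases n)
  have sep_y: "a \<bullet> y + b * (y \<bullet> \<sigma> - q) < c" using n(1) by simp
  have sep_E: "c < a \<bullet> x + b * r" if "V x \<le> ereal r" for x r
    using n(2) that by (force simp: E_def)
  \<comment> \<open>A bound \<open>k\<close> on the conjugate at \<open>\<tau>\<close> means that
    \<open>x \<bullet> \<tau> - k\<close> is an affine minorant of \<open>V\<close>; no such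
    minorant exceeds \<open>y \<bullet> \<sigma> - q\<close> at \<open>y\<close>.\<close>
  have conj_ge: "y \<bullet> \<tau> - k \<le> y \<bullet> \<sigma> - q" if "conjugate V \<tau> \<le> ereal k" for \<tau> k
    using subdifferential_conjugate_D[OF y, of \<tau>] that q by (cases "conjugate V \<tau>") auto
  have "b \<ge> 0"
  proof (rule ccontr)
    assume b: "\<not> b \<ge> 0"
    obtain x r where r: "V x = ereal r"
      using V(1) unfolding proper_fun_def by (metis ereal_cases)
    \<comment> \<open>The epigraph is unbounded upwards: for negative \<open>b\<close>, this height
      puts \<open>(x, s)\<close> in it but on the wrong side of the hyperplane.\<close>
    define s where "s = max r ((c - a \<bullet> x) / b)"
    have "c < a \<bullet> x + b * s" using r by (intro sep_E) (simp add: s_def)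
    moreover have "b * s \<le> b * ((c - a \<bullet> x) / b)"
      using b by (intro mult_left_mono_neg) (auto simp: s_def)
    ultimately show False using b by simp
  qed
  then consider "b > 0" | "b = 0" by linarith
  then show False
  proof cases
    case 1
    \<comment> \<open>Solving \<open>a \<bullet> x + b * r = c\<close> for \<open>r\<close> gives
      the slope and the constant of the minorant.\<close>
    have "conjugate V ((- 1 / b) *\<^sub>R a) \<le> ereal (- c / b)"
    proof (rule conjugate_le[OF V(1)])
      fix x r assume "V x = ereal r"
      then have "c < a \<bullet> x + b * r" by (intro sep_E) simp
      then have "c / b < (a \<bullet> x) / b + r" using 1 by (simp add: field_simps)
      then show "x \<bullet> ((- 1 / b) *\<^sub>R a) - r \<le> - c / b" by (simp add: inner_commute)
    qed
    from conj_ge[OF this] show False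
      using 1 sep_y by (simp add: inner_commute field_simps)
  next
    \<comment> \<open>A vertical hyperplane is dealt with by tilting the affine minorant of slope \<open>\<sigma>\<close>.\<close>
    case 2
    have "conjugate V (\<sigma> - a) \<le> ereal (q - c)"
    proof (rule conjugate_le[OF V(1)])
      fix x r assume r: "V x = ereal r"
      then have "c < a \<bullet> x" using sep_E[of x r] 2 by simp
      moreover have "x \<bullet> \<sigma> - q \<le> r" using fenchel_young[of V \<sigma> x] q r by simp
      ultimately show "x \<bullet> (\<sigma> - a) - r \<le> q - c"
        by (simp add: inner_diff_right inner_commute)
    qed
    \<comment> \<open>At \<open>y\<close> the tilted minorant exceeds
      \<open>y \<bullet> \<sigma> - q\<close> by \<open>c - a \<bullet> y\<close>, which is positive
      by \<open>sep_y\<close>.\<close>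
    from conj_ge[OF this] show False
      using 2 sep_y by (simp add: inner_diff_right inner_commute)
  qed
qed

theorem theorem5:
  fixes C :: "(real ^ 'n) set"
    and V :: "real ^ 'm \<Rightarrow> ereal"
    and \<Phi> :: "real ^ 'n \<Rightarrow> real ^ 'm"
    and xbar :: "real ^ 'n"
    and \<sigma>bar :: "real ^ 'm"
  assumes "C \<noteq> {}" and "convex C"
    and "proper_fun V" and "convex_fun V" and "lsc_fun V"
    and "locally_lipschitz \<Phi>"
    and "xbar \<in> C" and "\<sigma>bar \<in> conj_dom_plus C V \<Phi>"
    and "stationary_point C V \<Phi> xbar \<sigma>bar"
  shows "(\<forall>x\<in>C. \<forall>\<sigma>\<in>conj_dom_plus C V \<Phi>.
            lagrangian C V \<Phi> xbar \<sigma> \<le> lagrangian C V \<Phi> xbar \<sigma>bar \<and>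
            lagrangian C V \<Phi> xbar \<sigma>bar \<le> lagrangian C V \<Phi> x \<sigma>bar) \<and>
         (\<forall>x. primal C V \<Phi> xbar \<le> primal C V \<Phi> x)"
proof -
  have sub: "\<Phi> xbar \<in> subdifferential (conjugate V) \<sigma>bar"
    using assms(9) by (auto simp: stationary_point_def partial_sigma_def)
  then have fin: "\<bar>conjugate V \<sigma>bar\<bar> \<noteq> \<infinity>"
    by (auto simp: subdifferential_def)
  have L: "lagrangian C V \<Phi> x \<sigma> = ereal (\<Phi> x \<bullet> \<sigma>) - conjugate V \<sigma>"
    if "x \<in> C" "\<sigma> \<in> conj_dom_plus C V \<Phi>" for x \<sigma>
    using that by (simp add: lagrangian_def conj_dom_plus_def)
  have min: "lagrangian C V \<Phi> xbar \<sigma>bar \<le> lagrangian C V \<Phi> x \<sigma>bar" for x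
    using assms(9) by (auto simp: stationary_point_def partial_x_def subdifferential_def zero_ereal_def[symmetric])
  have max: "lagrangian C V \<Phi> xbar \<sigma> \<le> lagrangian C V \<Phi> xbar \<sigma>bar"
    if "\<sigma> \<in> conj_dom_plus C V \<Phi>" for \<sigma>
    using subdifferential_conjugate_D[OF sub] that by (simp add: L assms(7,8))
  \<comment> \<open>On \<open>C\<close> the objective majorises the Lagrangian at
    \<open>\<sigma>bar\<close> and does not exceed it at \<open>xbar\<close>, so a minimiser of the
    latter also minimises the former.\<close>
  have "primal C V \<Phi> xbar \<le> primal C V \<Phi> x" for x
  proof (cases "x \<in> C")
    case True
    have "V (\<Phi> xbar) \<le> lagrangian C V \<Phi> xbar \<sigma>bar"
      using subdifferential_conjugate_le[OF assms(3-5) sub] by (simp add: L assms(7,8))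
    also have "\<dots> \<le> lagrangian C V \<Phi> x \<sigma>bar" by (rule min)
    also have "\<dots> \<le> V (\<Phi> x)"
      using fenchel_young[OF fin] True by (simp add: L assms(8))
    finally show ?thesis using True assms(7) by (simp add: primal_def)
  qed (simp add: primal_def)
  with min max show ?thesis by blast
qed

end
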